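(* Let $(X,d)$ be a metric space, let $m\in X$, and let $\phi:X\times X\to\mathbb{R}$ be a nonnegative symmetric function. Then $d^{\phi,m}$ is a metric on $X$.
   Context: For $x,y\in X$ put $$\delta^{\phi,m}(x,y)=\min\left\{ d(x,y),\ \frac{1}{1+d(m,x)}+\phi(x,y)+\frac{1}{1+d(m,y)}\right\}.$$ For $n\in\mathbb{N}=\{1,2,\dots\}$ let $\Gamma^n_{x,y}$ be the set of all tuples $(x_0,\dots,x_n)$ of points of $X$ with $x_0=x$ and $x_n=y$, and let $\Gamma_{x,y}=\bigcup_{n\in\mathbb{N}}\Gamma^n_{x,y}$. Define $$d^{\phi,m}(x,y)=\inf\left\{\sum_{i=1}^n\delta^{\phi,m}(x_{i-1},x_i)\ :\ (x_0,\dots,x_n)\in\Gamma_{x,y},\ n\in\mathbb{N}\right\}.$$ "Symmetric" means $\phi(x,y)=\phi(y,x)$ for all $x,y\in X$. *)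

theory Defs
  imports "HOL-Analysis.Abstract_Metric_Spaces"
begin

definition delta_phi ::
  "('a \<Rightarrow> 'a \<Rightarrow> real) \<Rightarrow> ('a \<Rightarrow> 'a \<Rightarrow> real) \<Rightarrow> 'a \<Rightarrow> 'a \<Rightarrow> 'a \<Rightarrow> real" where
  "delta_phi d \<phi> m x y = min (d x y) (1 / (1 + d m x) + \<phi> x y + 1 / (1 + d m y))"

(* A tuple (x_0, ..., x_n) is the list [x_0, ..., x_n], of length n + 1. *)
definition chains_n :: "'a set \<Rightarrow> nat \<Rightarrow> 'a \<Rightarrow> 'a \<Rightarrow> 'a list set" where
  "chains_n X n x y = {xs. length xs = n + 1 \<and> set xs \<subseteq> X \<and> xs ! 0 = x \<and> xs ! n = y}"

(* The locale Metric_space asks for nonnegativity and symmetry on the whole type, not only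
   on the carrier. If x or y lies outside X there are no chains, and the infimum of the empty
   set of reals is an unspecified number; hence the value 0 there, as for Metric_space.fdist. *)
definition d_phi ::
  "'a set \<Rightarrow> ('a \<Rightarrow> 'a \<Rightarrow> real) \<Rightarrow> ('a \<Rightarrow> 'a \<Rightarrow> real) \<Rightarrow> 'a \<Rightarrow> 'a \<Rightarrow> 'a \<Rightarrow> real" where
  "d_phi X d \<phi> m x y =
     (if x \<in> X \<and> y \<in> X
      then Inf {(\<Sum>i = 1..n. delta_phi d \<phi> m (xs ! (i - 1)) (xs ! i)) | n xs.
                  n \<ge> 1 \<and> xs \<in> chains_n X n x y}
      else 0)"

end

theory Submission imports Defs begin

text \<open>
  The function \<open>d_phi\<close> is the infimum, over all chains from \<open>x\<close> to \<open>y\<close>, of the total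
  cost of the steps, each step costing \<open>delta_phi\<close>. For any nonnegative step cost \<open>c\<close> such an
  infimum is governed by two dual facts. From above, prepending one step to a chain gives
  \<open>D x z \<le> c x y + D y z\<close> (lemma \<open>chain_inf_step\<close>). From below, call \<open>f\<close> a
  \<^emph>\<open>potential\<close> if \<open>f u - f v \<le> c u v\<close> for all points; telescoping along a chain gives
  \<open>f x - f y \<le> D x y\<close> (lemma \<open>potential_le_chain_inf\<close>).

  The upper fact says that \<open>D _ z\<close> is itself a potential, and when \<open>c\<close> is symmetric so is
  \<open>- D _ z\<close>. The lower fact, applied to these two, is the triangle inequality and the symmetry
  of \<open>D\<close>, so that chains need not be concatenated or reversed.

  Definiteness is where the shape of \<open>delta_phi\<close> matters. A step costs either the
  distance \<open>d u v\<close>, or it is a jump, which costs at least the toll \<open>1 / (1 + d m u)\<close> at its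
  starting point. The toll is positive and 1-Lipschitz in \<open>u\<close>, so a chain from \<open>x\<close> cannot
  make it small by walking away from \<open>x\<close> unless the walk costs as much as is saved. Hence a chain from
  \<open>x\<close> to \<open>y\<close> costs at least \<open>d x y\<close> if it never jumps and at least the toll at \<open>x\<close> if it
  does. In the language above, \<open>\<lambda>u. min (d u y) (1 / (1 + d m u))\<close> is a potential.
\<close>

section \<open>The infimum of chain costs\<close>

definition chain_costs :: "'a set \<Rightarrow> ('a \<Rightarrow> 'a \<Rightarrow> real) \<Rightarrow> 'a \<Rightarrow> 'a \<Rightarrow> real set" where
  "chain_costs X c x y =
     {(\<Sum>i = 1..n. c (xs ! (i - 1)) (xs ! i)) | n xs. n \<ge> 1 \<and> xs \<in> chains_n X n x y}"

definition chain_inf :: "'a set \<Rightarrow> ('a \<Rightarrow> 'a \<Rightarrow> real) \<Rightarrow> 'a \<Rightarrow> 'a \<Rightarrow> real" where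
  "chain_inf X c x y = Inf (chain_costs X c x y)"

lemma single_step_cost:
  assumes "x \<in> X" "y \<in> X"
  shows "c x y \<in> chain_costs X c x y"
  unfolding chain_costs_def chains_n_def
  by (rule CollectI, rule exI[of _ 1], rule exI[of _ "[x, y]"]) (use assms in auto)

lemma prepend_step_cost:
  assumes "x \<in> X" "s \<in> chain_costs X c y z"
  shows "c x y + s \<in> chain_costs X c x z"
proof -
  obtain n xs where n: "n \<ge> 1" and xs: "xs \<in> chains_n X n y z"
    and s: "s = (\<Sum>i = 1..n. c (xs ! (i - 1)) (xs ! i))"
    using assms(2) unfolding chain_costs_def by blast
  have "(\<Sum>i = 1..Suc n. c ((x # xs) ! (i - 1)) ((x # xs) ! i))
      = c x (xs ! 0) + (\<Sum>i = 1..n. c ((x # xs) ! i) (xs ! i))"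
    by (simp add: sum.atLeast_Suc_atMost sum.shift_bounds_cl_Suc_ivl del: sum.cl_ivl_Suc)
  also have "(\<Sum>i = 1..n. c ((x # xs) ! i) (xs ! i)) = s"
    unfolding s by (rule sum.cong) (auto simp: nth_Cons')
  finally have "(\<Sum>i = 1..Suc n. c ((x # xs) ! (i - 1)) ((x # xs) ! i)) = c x y + s"
    using xs by (simp add: chains_n_def)
  moreover have "x # xs \<in> chains_n X (Suc n) x z"
    using xs assms(1) by (simp add: chains_n_def)
  ultimately show ?thesis
    unfolding chain_costs_def by (intro CollectI exI[of _ "Suc n"] exI[of _ "x # xs"]) simp
qed

text \<open>Along a chain the differences of a potential telescope.\<close>
lemma potential_le_chain_cost:
  assumes pot: "\<And>u v. u \<in> X \<Longrightarrow> v \<in> X \<Longrightarrow> f u - f v \<le> c u v"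
    and "s \<in> chain_costs X c x y"
  shows "f x - f y \<le> s"
proof -
  obtain n xs where xs: "xs \<in> chains_n X n x y"
    and s: "s = (\<Sum>i = 1..n. c (xs ! (i - 1)) (xs ! i))"
    using assms(2) unfolding chain_costs_def by blast
  have in_X: "xs ! i \<in> X" if "i \<le> n" for i
    using xs that by (auto simp: chains_n_def)
  have "f (xs ! 0) - f (xs ! k) \<le> (\<Sum>i = 1..k. c (xs ! (i - 1)) (xs ! i))" if "k \<le> n" for k
    using that
  proof (induction k)
    case (Suc k)
    then show ?case using pot[OF in_X[of k] in_X[of "Suc k"]] by simp
  qed simp
  from this[of n] show ?thesis using xs s by (simp add: chains_n_def)
qed

lemma potential_le_chain_inf:
  assumes "\<And>u v. u \<in> X \<Longrightarrow> v \<in> X \<Longrightarrow> f u - f v \<le> c u v" and "x \<in> X" "y \<in> X"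
  shows "f x - f y \<le> chain_inf X c x y"
  unfolding chain_inf_def
proof (rule cInf_greatest)
  show "chain_costs X c x y \<noteq> {}" using single_step_cost[OF assms(2,3)] by blast
  show "f x - f y \<le> s" if "s \<in> chain_costs X c x y" for s
    using assms(1) that by (rule potential_le_chain_cost)
qed

text \<open>A constant function is a potential for a nonnegative cost.\<close>
lemma chain_cost_nonneg:
  assumes "\<And>u v. u \<in> X \<Longrightarrow> v \<in> X \<Longrightarrow> 0 \<le> c u v" and "s \<in> chain_costs X c x y"
  shows "0 \<le> s"
  using potential_le_chain_cost[of X "\<lambda>_. 0" c s x y] assms by simp

lemma chain_inf_le_cost:
  assumes "\<And>u v. u \<in> X \<Longrightarrow> v \<in> X \<Longrightarrow> 0 \<le> c u v" and "s \<in> chain_costs X c x y"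
  shows "chain_inf X c x y \<le> s"
  unfolding chain_inf_def
proof (rule cInf_lower[OF assms(2)])
  show "bdd_below (chain_costs X c x y)"
    by (rule bdd_belowI[of _ 0]) (rule chain_cost_nonneg[OF assms(1)])
qed

lemma chain_inf_step:
  assumes nonneg: "\<And>u v. u \<in> X \<Longrightarrow> v \<in> X \<Longrightarrow> 0 \<le> c u v"
    and "x \<in> X" "y \<in> X" "z \<in> X"
  shows "chain_inf X c x z \<le> c x y + chain_inf X c y z"
proof -
  have "chain_inf X c x z - c x y \<le> s" if "s \<in> chain_costs X c y z" for s
    using chain_inf_le_cost[of X c, OF nonneg prepend_step_cost[OF assms(2) that]] by simp
  moreover have "chain_costs X c y z \<noteq> {}" using single_step_cost[OF assms(3,4)] by blast
  ultimately have "chain_inf X c x z - c x y \<le> chain_inf X c y z"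
    unfolding chain_inf_def[of X c y z] by (intro cInf_greatest)
  then show ?thesis by simp
qed

lemma chain_inf_triangle:
  assumes nonneg: "\<And>u v. u \<in> X \<Longrightarrow> v \<in> X \<Longrightarrow> 0 \<le> c u v"
    and "x \<in> X" "y \<in> X" "z \<in> X"
  shows "chain_inf X c x z \<le> chain_inf X c x y + chain_inf X c y z"
proof -
  have "chain_inf X c u z - chain_inf X c v z \<le> c u v" if "u \<in> X" "v \<in> X" for u v
    using chain_inf_step[of X c, OF nonneg that assms(4)] by simp
  from potential_le_chain_inf[of X "\<lambda>u. chain_inf X c u z", OF this assms(2,3)]
  show ?thesis by simp
qed

lemma chain_inf_self:
  assumes nonneg: "\<And>u v. u \<in> X \<Longrightarrow> v \<in> X \<Longrightarrow> 0 \<le> c u v"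
    and "x \<in> X" "c x x = 0"
  shows "chain_inf X c x x = 0"
proof (rule antisym)
  show "chain_inf X c x x \<le> 0"
    using chain_inf_le_cost[of X c, OF nonneg single_step_cost[OF assms(2,2)]] assms(3) by simp
  show "0 \<le> chain_inf X c x x"
    using potential_le_chain_inf[of X "\<lambda>_. 0" c x x] assms by simp
qed

text \<open>
  For a symmetric cost, \<open>chain_inf_step\<close> also makes \<open>\<lambda>u. - chain_inf X c u x\<close> a potential;
  its drop from \<open>x\<close> to \<open>y\<close> is \<open>chain_inf X c y x - chain_inf X c x x\<close>, where the
  subtracted term vanishes.
\<close>
lemma chain_inf_commute:
  assumes nonneg: "\<And>u v. u \<in> X \<Longrightarrow> v \<in> X \<Longrightarrow> 0 \<le> c u v"
    and sym: "\<And>u v. u \<in> X \<Longrightarrow> v \<in> X \<Longrightarrow> c u v = c v u"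
    and self: "\<And>u. u \<in> X \<Longrightarrow> c u u = 0"
    and "x \<in> X" "y \<in> X"
  shows "chain_inf X c x y = chain_inf X c y x"
proof -
  have "chain_inf X c b a \<le> chain_inf X c a b" if "a \<in> X" "b \<in> X" for a b
  proof -
    have "- chain_inf X c u a - - chain_inf X c v a \<le> c u v" if "u \<in> X" "v \<in> X" for u v
      using chain_inf_step[of X c, OF nonneg that(2,1) \<open>a \<in> X\<close>] sym[OF that] by simp
    from potential_le_chain_inf[of X "\<lambda>u. - chain_inf X c u a", OF this that]
    show ?thesis using chain_inf_self[of X c, OF nonneg \<open>a \<in> X\<close> self] that by simp
  qed
  then show ?thesis using assms(4,5) by (simp add: antisym)
qed

section \<open>The step cost with jumps\<close>

lemma d_phi_eq_chain_inf:
  assumes "x \<in> X" "y \<in> X"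
  shows "d_phi X d \<phi> m x y = chain_inf X (delta_phi d \<phi> m) x y"
  using assms by (simp add: d_phi_def chain_inf_def chain_costs_def)

context Metric_space
begin

lemma delta_phi_nonneg:
  assumes "0 \<le> \<phi> x y"
  shows "0 \<le> delta_phi d \<phi> m x y"
  using assms by (simp add: delta_phi_def)

lemma delta_phi_commute:
  assumes "\<phi> x y = \<phi> y x"
  shows "delta_phi d \<phi> m x y = delta_phi d \<phi> m y x"
  using assms by (simp add: delta_phi_def commute add.commute add.left_commute)

lemma delta_phi_self:
  assumes "x \<in> M" "0 \<le> \<phi> x x"
  shows "delta_phi d \<phi> m x x = 0"
  using assms by (simp add: delta_phi_def)

text \<open>
  The function \<open>t \<mapsto> 1 / (1 + t)\<close> is 1-Lipschitz on \<open>[0, \<infinity>)\<close>, because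
  \<open>1 / (1 + a) - 1 / (1 + b) = (b - a) / ((1 + a) (1 + b))\<close> and the denominator is at least 1.
\<close>
lemma toll_diff_le_dist:
  assumes "m \<in> M" "u \<in> M" "v \<in> M"
  shows "1 / (1 + d m u) - 1 / (1 + d m v) \<le> d u v"
proof -
  have pos: "0 < 1 + d m u" "0 < 1 + d m v" by (simp_all add: add_pos_nonneg)
  have "1 * 1 \<le> (1 + d m u) * (1 + d m v)" by (intro mult_mono) auto
  then have "d u v * 1 \<le> d u v * ((1 + d m u) * (1 + d m v))"
    by (intro mult_left_mono) auto
  moreover have "d m v - d m u \<le> d u v" using triangle[OF assms] by simp
  ultimately have "d m v - d m u \<le> d u v * ((1 + d m u) * (1 + d m v))" by simp
  moreover have "1 / (1 + d m u) - 1 / (1 + d m v)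
      = (d m v - d m u) / ((1 + d m u) * (1 + d m v))"
    using pos by (simp add: divide_simps)
  ultimately show ?thesis using pos by (simp add: pos_divide_le_eq)
qed

text \<open>
  The minimum of two 1-Lipschitz functions is 1-Lipschitz, which deals with a step that costs
  \<open>d u v\<close>. A jump costs at least the toll at \<open>u\<close>, hence at least the value of the minimum at
  \<open>u\<close>, while its value at \<open>v\<close> is nonnegative.
\<close>
lemma min_dist_toll_potential:
  assumes "m \<in> M" "y \<in> M" "u \<in> M" "v \<in> M" "0 \<le> \<phi> u v"
  shows "min (d u y) (1 / (1 + d m u)) - min (d v y) (1 / (1 + d m v)) \<le> delta_phi d \<phi> m u v"
proof -
  have "d u y \<le> d u v + d v y" using triangle assms by blast
  moreover have "1 / (1 + d m u) - 1 / (1 + d m v) \<le> d u v"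
    using toll_diff_le_dist assms by blast
  moreover have "0 \<le> 1 / (1 + d m v)" "0 \<le> d v y" by simp_all
  ultimately show ?thesis using assms(5) unfolding delta_phi_def by linarith
qed

lemma min_dist_toll_le_chain_inf:
  assumes "m \<in> M" "\<And>u v. u \<in> M \<Longrightarrow> v \<in> M \<Longrightarrow> 0 \<le> \<phi> u v" "x \<in> M" "y \<in> M"
  shows "min (d x y) (1 / (1 + d m x)) \<le> chain_inf M (delta_phi d \<phi> m) x y"
proof -
  have "min (d x y) (1 / (1 + d m x)) - min (d y y) (1 / (1 + d m y))
      \<le> chain_inf M (delta_phi d \<phi> m) x y"
    using min_dist_toll_potential[OF assms(1,4)] assms(2-4)
    by (intro potential_le_chain_inf) auto
  then show ?thesis using assms(4) by simp
qed

end

section \<open>The metric\<close>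

theorem theorem1p1:
  fixes X :: "'a set" and d :: "'a \<Rightarrow> 'a \<Rightarrow> real" and m :: 'a
    and \<phi> :: "'a \<Rightarrow> 'a \<Rightarrow> real"
  assumes "Metric_space X d"
    and "m \<in> X"
    and "\<And>x y. x \<in> X \<Longrightarrow> y \<in> X \<Longrightarrow> \<phi> x y \<ge> 0"
    and "\<And>x y. x \<in> X \<Longrightarrow> y \<in> X \<Longrightarrow> \<phi> x y = \<phi> y x"
  shows "Metric_space X (d_phi X d \<phi> m)"
proof -
  interpret Metric_space X d by (rule assms(1))
  let ?c = "delta_phi d \<phi> m"
  have nonneg: "0 \<le> ?c u v" if "u \<in> X" "v \<in> X" for u v
    using delta_phi_nonneg assms(3) that by blast
  have sym: "?c u v = ?c v u" if "u \<in> X" "v \<in> X" for u v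
    using delta_phi_commute assms(4) that by blast
  have self: "?c u u = 0" if "u \<in> X" for u
    using delta_phi_self assms(3) that by blast
  have lower: "min (d x y) (1 / (1 + d m x)) \<le> d_phi X d \<phi> m x y" if "x \<in> X" "y \<in> X" for x y
    using min_dist_toll_le_chain_inf assms(2,3) that by (simp add: d_phi_eq_chain_inf)
  show ?thesis
  proof
    fix x y
    show "0 \<le> d_phi X d \<phi> m x y"
    proof (cases "x \<in> X \<and> y \<in> X")
      case True
      have "0 \<le> min (d x y) (1 / (1 + d m x))" by simp
      also have "\<dots> \<le> d_phi X d \<phi> m x y" using lower True by blast
      finally show ?thesis .
    qed (auto simp: d_phi_def)
    show "d_phi X d \<phi> m x y = d_phi X d \<phi> m y x"
    proof (cases "x \<in> X \<and> y \<in> X")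
      case True
      then show ?thesis
        using chain_inf_commute[of X ?c, OF nonneg sym self] by (simp add: d_phi_eq_chain_inf)
    qed (auto simp: d_phi_def)
  next
    fix x y assume xy: "x \<in> X" "y \<in> X"
    show "d_phi X d \<phi> m x y = 0 \<longleftrightarrow> x = y"
    proof
      assume "d_phi X d \<phi> m x y = 0"
      moreover have "0 < 1 / (1 + d m x)" by (simp add: add_pos_nonneg)
      ultimately have "d x y \<le> 0" using lower[OF xy] by linarith
      moreover have "0 \<le> d x y" by simp
      ultimately show "x = y" using zero[OF xy] by simp
    next
      assume "x = y"
      then show "d_phi X d \<phi> m x y = 0"
        using chain_inf_self[of X ?c, OF nonneg] self xy by (simp add: d_phi_eq_chain_inf)
    qed
  next
    fix x y z assume "x \<in> X" "y \<in> X" "z \<in> X"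
    then show "d_phi X d \<phi> m x z \<le> d_phi X d \<phi> m x y + d_phi X d \<phi> m y z"
      using chain_inf_triangle[of X ?c, OF nonneg] by (simp add: d_phi_eq_chain_inf)
  qed
qed

end
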